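(* Let $(L,(\cdot,\cdot),\Phi)$ be a p.n. root lattice. Let $A\subset\Phi$ be any set of roots which generates the lattice $L$ as a $\mathbb{Z}$-module. Then $A$ contains a $\mathbb{Z}$-basis of $L$.
   Context: A lattice is a free $\mathbb{Z}$-module $L$ of finite rank; $L_{\mathbb{R}}=L\otimes\mathbb{R}$. A p.n. ("possibly nonreduced") root lattice is a triple $(L,(\cdot,\cdot),\Phi)$ where $L$ is a lattice, $(\cdot,\cdot)$ is a scalar product on $L_{\mathbb{R}}$, and $\Phi\subset L\setminus\{0\}$ is a finite set (whose elements are called roots) such that: $\Phi$ generates $L$ as a $\mathbb{Z}$-module; for all $\alpha\in\Phi$ the reflection $s_\alpha(x)=x-\langle x,\alpha\rangle\alpha$ satisfies $s_\alpha(\Phi)=\Phi$; and $\langle\beta,\alpha\rangle:=2(\beta,\alpha)/(\alpha,\alpha)\in\mathbb{Z}$ for all $\alpha,\beta\in\Phi$. (It is not required that $\Phi\cap\mathbb{R}\alpha=\{\pm\alpha\}$.) *)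

theory Defs
  imports Complex_Main
begin

text \<open>A lattice \<open>L\<close> is a subset of a real vector space, and \<open>L \<otimes> \<real>\<close> is its real span.
  The notions of \<open>\<int>\<close>-span and \<open>\<int>\<close>-independence are those of the library locale
  \<^locale>\<open>module\<close> for the action of the integers.\<close>

definition zscale :: "int \<Rightarrow> 'v::real_vector \<Rightarrow> 'v"
  where "zscale n x = real_of_int n *\<^sub>R x"

global_interpretation zmod: module "zscale :: int \<Rightarrow> 'v::real_vector \<Rightarrow> 'v"
  defines zspan = zmod.span and zdependent = zmod.dependent
  by unfold_locales (simp_all add: zscale_def algebra_simps)

definition zbasis :: "'v::real_vector set \<Rightarrow> 'v set \<Rightarrow> bool"
  where "zbasis B L \<longleftrightarrow> \<not> zdependent B \<and> zspan B = L"

text \<open>Independence of the basis over the reals is what makes the real span of \<open>L\<close> a model of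
  \<open>L \<otimes> \<real>\<close>; it excludes, for instance, \<open>\<int> + \<int>\<surd>2\<close> inside the reals.\<close>

definition zlattice :: "'v::real_vector set \<Rightarrow> bool"
  where "zlattice L \<longleftrightarrow> (\<exists>B. finite B \<and> zbasis B L \<and> independent B)"

definition scalar_product_on :: "'v::real_vector set \<Rightarrow> ('v \<Rightarrow> 'v \<Rightarrow> real) \<Rightarrow> bool"
  where "scalar_product_on V ip \<longleftrightarrow>
    (\<forall>x\<in>V. \<forall>y\<in>V. ip x y = ip y x) \<and>
    (\<forall>x\<in>V. \<forall>y\<in>V. \<forall>z\<in>V. ip (x + y) z = ip x z + ip y z) \<and>
    (\<forall>c. \<forall>x\<in>V. \<forall>y\<in>V. ip (c *\<^sub>R x) y = c * ip x y) \<and>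
    (\<forall>x\<in>V. x \<noteq> 0 \<longrightarrow> ip x x > 0)"

definition cartan_number :: "('v \<Rightarrow> 'v \<Rightarrow> real) \<Rightarrow> 'v \<Rightarrow> 'v \<Rightarrow> real"
  where "cartan_number ip \<beta> \<alpha> = 2 * ip \<beta> \<alpha> / ip \<alpha> \<alpha>"

definition root_reflection :: "('v \<Rightarrow> 'v \<Rightarrow> real) \<Rightarrow> 'v \<Rightarrow> 'v \<Rightarrow> 'v::real_vector"
  where "root_reflection ip \<alpha> x = x - cartan_number ip x \<alpha> *\<^sub>R \<alpha>"

locale pn_root_lattice =
  fixes L :: "'v::real_vector set"
    and ip :: "'v \<Rightarrow> 'v \<Rightarrow> real"
    and \<Phi> :: "'v set"
  assumes lattice: "zlattice L"
    and scalar_product: "scalar_product_on (span L) ip"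
    and finite_roots: "finite \<Phi>"
    and roots_subset: "\<Phi> \<subseteq> L - {0}"
    and roots_generate: "zspan \<Phi> = L"
    and reflection_roots: "\<And>\<alpha>. \<alpha> \<in> \<Phi> \<Longrightarrow> root_reflection ip \<alpha> ` \<Phi> = \<Phi>"
    and cartan_integral: "\<And>\<alpha> \<beta>. \<alpha> \<in> \<Phi> \<Longrightarrow> \<beta> \<in> \<Phi> \<Longrightarrow> cartan_number ip \<beta> \<alpha> \<in> \<int>"

end

theory Submission
  imports Defs
begin

text \<open>
  Call a linear relation \<open>\<Sum>a\<in>C. c a * a = 0\<close> a primitive circuit if \<open>C\<close> is a minimal dependent
  set and the integers \<open>c a\<close>, all nonzero, have greatest common divisor 1. If one of them is
  \<open>\<plusminus>1\<close>, then the corresponding vector lies in the \<open>\<int>\<close>-span of the others and may be dropped from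
  a generating set. So it suffices that \<^emph>\<open>every primitive circuit of roots has a coefficient\<close>
  \<open>\<plusminus>1\<close>; a minimal generating subset of \<open>A\<close> is then independent.

  The argument is the one that moves a point into the fundamental alcove of an affine reflection
  group. Replacing roots by their negatives, suppose that all \<open>c a\<close> are positive. The maps
  \<open>g : C \<rightarrow> \<int>\<close> with \<open>\<Sum>a\<in>C. c a * g a = 1\<close> form a set that is nonempty by Bezout. If a \<open>g\<close>
  in this set is nonnegative, then \<open>c a * g a = 1\<close> for some \<open>a\<close>, and \<open>c a = 1\<close>. The set is stable
  under the affine reflections
  \<open>g b \<mapsto> g b - g a * \<langle>b, a\<rangle>\<close>, because the Cartan numbers are integers and \<open>\<langle>_, a\<rangle>\<close> respects
  the relation. Fix the interior point \<open>t\<close> of the alcove with constant value \<open>1 / T\<close>, where \<open>T\<close> is the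
  sum of the coefficients. Reflecting \<open>g\<close> in a wall \<open>g a = 0\<close> that separates it from \<open>t\<close>, that is,
  with \<open>g a < 0\<close>, brings it closer to \<open>t\<close>. A point \<open>g\<close> closest to \<open>t\<close> is therefore nonnegative.

  To stay within the integers, the proof works with \<open>F = T * (g - t)\<close>, which vanishes on the
  relation and so extends to a functional on the \<open>\<int>\<close>-span \<open>M\<close> of \<open>C\<close>. The distance
  is measured by the sum of \<open>(F \<beta>)\<^sup>2\<close> over all roots \<open>\<beta>\<close> in \<open>M\<close>: it is a natural number, and the
  linear reflections in \<open>C\<close> preserve it because they permute these roots
  (\<open>root_energy_shifted_reflection\<close>, \<open>circuit_has_unit_coefficient\<close>).
\<close>

section \<open>Integer relations and circuits\<close>

lemma bezout_finite:
  fixes c :: "'a \<Rightarrow> int"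
  assumes "finite C"
  shows "\<exists>g. (\<Sum>a\<in>C. c a * g a) = Gcd (c ` C)"
  using assms
proof (induction C)
  case empty
  then show ?case by simp
next
  case (insert b C)
  then obtain g where g: "(\<Sum>a\<in>C. c a * g a) = Gcd (c ` C)" by blast
  obtain u v where uv: "u * c b + v * Gcd (c ` C) = gcd (c b) (Gcd (c ` C))"
    using bezout_int by blast
  have "(\<Sum>a\<in>insert b C. c a * (if a = b then u else v * g a))
      = c b * u + (\<Sum>a\<in>C. c a * (if a = b then u else v * g a))"
    using insert by simp
  also have "(\<Sum>a\<in>C. c a * (if a = b then u else v * g a)) = (\<Sum>a\<in>C. v * (c a * g a))"
    using insert by (intro sum.cong) auto
  also have "\<dots> = v * Gcd (c ` C)"
    by (simp add: g flip: sum_distrib_left)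
  finally show ?case
    using uv by (intro exI[of _ "\<lambda>a. if a = b then u else v * g a"]) (simp add: mult.commute)
qed

definition zcomb :: "'v::real_vector set \<Rightarrow> ('v \<Rightarrow> int) \<Rightarrow> 'v"
  where "zcomb C n = (\<Sum>a\<in>C. zscale (n a) a)"

lemma zcomb_add: "zcomb C (\<lambda>a. m a + n a) = zcomb C m + zcomb C n"
  by (simp add: zcomb_def zmod.scale_left_distrib sum.distrib)

lemma zcomb_diff: "zcomb C (\<lambda>a. m a - n a) = zcomb C m - zcomb C n"
  by (simp add: zcomb_def zmod.scale_left_diff_distrib sum_subtractf)

lemma zcomb_scale: "zcomb C (\<lambda>a. k * n a) = zscale k (zcomb C n)"
  by (simp add: zcomb_def zmod.scale_sum_right)

lemma zcomb_single: "finite C \<Longrightarrow> a \<in> C \<Longrightarrow> zcomb C (\<lambda>b. if b = a then 1 else 0) = a"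
  unfolding zcomb_def by (subst sum.remove[of _ a]) auto

lemma zscale_eq_0_iff: "zscale k x = 0 \<longleftrightarrow> k = 0 \<or> x = 0"
  by (simp add: zscale_def)

lemma zspan_zcomb: "finite C \<Longrightarrow> zspan C = range (zcomb C)"
  unfolding zcomb_def using zmod.span_finite[of C] by auto

lemma zdependent_zcomb:
  "finite C \<Longrightarrow> zdependent C \<longleftrightarrow> (\<exists>n. zcomb C n = 0 \<and> (\<exists>a\<in>C. n a \<noteq> 0))"
  unfolding zcomb_def using zmod.dependent_finite[of C] by auto

text \<open>The last clause says that every relation on \<open>C\<close> is proportional to \<open>c\<close>. Since no
  coefficient vanishes, this is minimality of the dependent set \<open>C\<close> in the form in which it is
  used; cross-multiplication avoids passing to rational coefficients.\<close>

definition primitive_circuit :: "'v::real_vector set \<Rightarrow> ('v \<Rightarrow> int) \<Rightarrow> bool"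
  where "primitive_circuit C c \<longleftrightarrow> finite C \<and> C \<noteq> {} \<and> (\<forall>a\<in>C. c a \<noteq> 0) \<and>
    zcomb C c = 0 \<and> Gcd (c ` C) = 1 \<and>
    (\<forall>n. zcomb C n = 0 \<longrightarrow> (\<forall>a\<in>C. \<forall>b\<in>C. c b * n a = n b * c a))"

text \<open>In a minimal dependent set, a relation that vanishes at one vector vanishes everywhere.
  This gives nonvanishing of the coefficients and, applied to a combination of two relations that
  cancels at one vector, their proportionality. A common factor can be divided out because the
  ambient real vector space has no torsion.\<close>

lemma zdependent_contains_circuit:
  assumes "finite A" "zdependent A"
  obtains C c where "C \<subseteq> A" "primitive_circuit C c"
proof -
  define D where "D = {C. C \<subseteq> A \<and> zdependent C}"
  have "finite D" "D \<noteq> {}"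
    using assms by (auto simp: D_def)
  then obtain C where C: "C \<in> D" and min: "\<And>E. E \<in> D \<Longrightarrow> E \<subseteq> C \<Longrightarrow> C = E"
    using finite_has_minimal[of D] by blast
  have CA: "C \<subseteq> A" and dep: "zdependent C" using C by (auto simp: D_def)
  have fin: "finite C" using CA assms finite_subset by blast
  have full: "n a = 0 \<Longrightarrow> n b = 0" if n: "zcomb C n = 0" and ab: "a \<in> C" "b \<in> C" for n a b
  proof (rule ccontr)
    assume a0: "n a = 0" and b0: "n b \<noteq> 0"
    have "zcomb (C - {a}) n = 0"
      using n a0 fin ab unfolding zcomb_def by (subst (asm) sum.remove[of _ a]) auto
    moreover have "b \<in> C - {a}" using ab a0 b0 by auto
    ultimately have "zdependent (C - {a})"
      using fin b0 by (subst zdependent_zcomb) auto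
    then have "C - {a} \<in> D" using CA by (auto simp: D_def)
    with min[of "C - {a}"] ab show False by blast
  qed
  obtain u b where u: "zcomb C u = 0" and b: "b \<in> C" "u b \<noteq> 0"
    using dep fin zdependent_zcomb by blast
  have u0: "u a \<noteq> 0" if "a \<in> C" for a using full[OF u that b(1)] b by blast
  define d where "d = Gcd (u ` C)"
  have d0: "d \<noteq> 0" using b by (auto simp: d_def Gcd_0_iff)
  have dvd: "d dvd u a" if "a \<in> C" for a using that by (simp add: d_def)
  define c where "c = (\<lambda>a. u a div d)"
  have uc: "u a = d * c a" if "a \<in> C" for a using dvd[OF that] by (simp add: c_def)
  have "zcomb C u = zcomb C (\<lambda>a. d * c a)"
    unfolding zcomb_def by (intro sum.cong) (simp_all add: uc)
  then have c_rel: "zcomb C c = 0"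
    using u d0 by (simp add: zcomb_scale zscale_eq_0_iff)
  have "d = Gcd ((*) d ` (c ` C))"
    unfolding d_def image_image using uc by (intro arg_cong[of _ _ Gcd] image_cong) (auto simp: d_def)
  also have "\<dots> = normalize (d * Gcd (c ` C))"
    by (rule Gcd_mult)
  finally have "d = normalize (d * Gcd (c ` C))" .
  moreover have "d \<ge> 0" by (simp add: d_def)
  with d0 have "d > 0" by simp
  ultimately have gcd1: "Gcd (c ` C) = 1" by (simp add: abs_mult)
  have c0: "c a \<noteq> 0" if "a \<in> C" for a using u0[OF that] uc[OF that] by auto
  have "c b * n a = n b * c a" if n: "zcomb C n = 0" and ab: "a \<in> C" "b \<in> C" for n a b
  proof -
    have "zcomb C (\<lambda>x. c b * n x - n b * c x) = 0"
      by (simp add: zcomb_diff zcomb_scale n c_rel)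
    from full[OF this ab(2,1)] show ?thesis by simp
  qed
  then have "primitive_circuit C c"
    using fin b c0 c_rel gcd1 unfolding primitive_circuit_def by blast
  with CA that show thesis by blast
qed

section \<open>Integral functionals\<close>

definition zlinear_on :: "'v::real_vector set \<Rightarrow> ('v \<Rightarrow> int) \<Rightarrow> bool"
  where "zlinear_on M F \<longleftrightarrow> (\<forall>x\<in>M. \<forall>y\<in>M. \<forall>n. F (x + zscale n y) = F x + n * F y)"

lemma zlinear_onD:
  "zlinear_on M F \<Longrightarrow> x \<in> M \<Longrightarrow> y \<in> M \<Longrightarrow> F (x + zscale n y) = F x + n * F y"
  by (auto simp: zlinear_on_def)

lemma zlinear_on_subset: "zlinear_on M F \<Longrightarrow> N \<subseteq> M \<Longrightarrow> zlinear_on N F"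
  by (auto simp: zlinear_on_def)

lemma zlinear_on_zero: "zlinear_on M F \<Longrightarrow> 0 \<in> M \<Longrightarrow> F 0 = 0"
  using zlinear_onD[of M F 0 0 1] by simp

lemma zlinear_on_diff_scale:
  "zlinear_on M F \<Longrightarrow> zlinear_on M G \<Longrightarrow> zlinear_on M (\<lambda>x. F x - k * G x)"
  by (auto simp: zlinear_on_def algebra_simps)

lemma zlinear_on_zcomb:
  assumes F: "zlinear_on (zspan C) F" and "finite C"
  shows "F (zcomb C n) = (\<Sum>a\<in>C. n a * F a)"
proof -
  have F0: "F 0 = 0" by (rule zlinear_on_zero[OF F zmod.span_zero])
  have "F (zcomb B n) = (\<Sum>a\<in>B. n a * F a) \<and> zcomb B n \<in> zspan C" if "B \<subseteq> C" for B
    using finite_subset[OF that \<open>finite C\<close>] that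
  proof (induction B)
    case empty
    then show ?case by (simp add: zcomb_def F0 zmod.span_zero)
  next
    case (insert b B)
    have eq: "zcomb (insert b B) n = zcomb B n + zscale (n b) b"
      using insert by (simp add: zcomb_def)
    have "b \<in> zspan C" using insert by (auto intro: zmod.span_base)
    then show ?case
      using insert zlinear_onD[OF F, of "zcomb B n" b "n b"]
      by (auto simp: eq intro: zmod.span_add zmod.span_scale)
  qed
  then show ?thesis by blast
qed

text \<open>All relations on a circuit are proportional to \<open>c\<close>, so values compatible with the relation \<open>c\<close>
  are compatible with every relation.\<close>

lemma circuit_extend_zlinear:
  assumes circ: "primitive_circuit C c" and rel: "(\<Sum>a\<in>C. c a * f a) = 0"
  obtains F where "zlinear_on (zspan C) F" "\<And>a. a \<in> C \<Longrightarrow> F a = f a"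
proof -
  have fin: "finite C" using circ by (simp add: primitive_circuit_def)
  define e where "e n = (\<Sum>a\<in>C. n a * f a)" for n :: "'a \<Rightarrow> int"
  have e0: "e n = 0" if n: "zcomb C n = 0" for n
  proof -
    obtain b where b: "b \<in> C" "c b \<noteq> 0" using circ by (auto simp: primitive_circuit_def)
    have "c b * e n = (\<Sum>a\<in>C. n b * (c a * f a))"
      unfolding e_def sum_distrib_left
    proof (rule sum.cong)
      fix a assume "a \<in> C"
      then have "c b * n a = n b * c a"
        using circ n b by (auto simp: primitive_circuit_def)
      then show "c b * (n a * f a) = n b * (c a * f a)" by (metis mult.assoc)
    qed simp
    also have "\<dots> = 0" using rel by (simp flip: sum_distrib_left)
    finally show ?thesis using b by simp
  qed
  have e_eq: "e m = e n" if "zcomb C m = zcomb C n" for m n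
    using e0[of "\<lambda>a. m a - n a"] that by (simp add: zcomb_diff e_def algebra_simps sum_subtractf)
  define F where "F x = e (SOME n. zcomb C n = x)" for x
  have F: "F (zcomb C n) = e n" for n
    unfolding F_def by (rule e_eq, rule someI[of "\<lambda>m. zcomb C m = zcomb C n" n]) (rule refl)
  have "zlinear_on (zspan C) F"
    unfolding zlinear_on_def zspan_zcomb[OF fin]
  proof (intro ballI allI)
    fix x y k assume "x \<in> range (zcomb C)" "y \<in> range (zcomb C)"
    then obtain m n where xy: "x = zcomb C m" "y = zcomb C n" by blast
    have "F (x + zscale k y) = e (\<lambda>a. m a + k * n a)"
      by (simp add: xy zcomb_add zcomb_scale flip: F)
    also have "\<dots> = F x + k * F y"
      by (simp add: xy F e_def algebra_simps sum.distrib sum_distrib_left)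
    finally show "F (x + zscale k y) = F x + k * F y" .
  qed
  moreover have "F a = f a" if "a \<in> C" for a
  proof -
    have "F a = e (\<lambda>b. if b = a then 1 else 0)"
      using F zcomb_single[OF fin that] by metis
    also have "\<dots> = f a" unfolding e_def using fin that by (subst sum.remove[of _ a]) auto
    finally show ?thesis .
  qed
  ultimately show thesis using that by blast
qed

section \<open>Reflections and the energy of a functional\<close>

context pn_root_lattice
begin

definition cartan_int :: "'v \<Rightarrow> 'v \<Rightarrow> int"
  where "cartan_int x a = \<lfloor>cartan_number ip x a\<rfloor>"

lemma root_in_L: "a \<in> \<Phi> \<Longrightarrow> a \<in> L" and root_nonzero: "a \<in> \<Phi> \<Longrightarrow> a \<noteq> 0"
  using roots_subset by auto

lemma cartan_number_add_scale:
  assumes "x \<in> L" "y \<in> L" "a \<in> \<Phi>"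
  shows "cartan_number ip (x + zscale n y) a = cartan_number ip x a + n * cartan_number ip y a"
proof -
  have sp: "x \<in> span L" "y \<in> span L" "zscale n y \<in> span L" "a \<in> span L"
    using assms root_in_L by (auto simp: zscale_def intro: span_base span_scale)
  have "ip (x + zscale n y) a = ip x a + ip (zscale n y) a"
    using scalar_product sp unfolding scalar_product_on_def by blast
  also have "ip (zscale n y) a = n * ip y a"
    using scalar_product sp unfolding scalar_product_on_def zscale_def by blast
  finally show ?thesis by (simp add: cartan_number_def add_divide_distrib algebra_simps)
qed

lemma cartan_number_self:
  assumes "a \<in> \<Phi>"
  shows "cartan_number ip a a = 2"
proof -
  have "ip a a > 0"
    using scalar_product assms root_in_L root_nonzero span_base
    unfolding scalar_product_on_def by metis
  then show ?thesis by (simp add: cartan_number_def)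
qed

lemma cartan_number_integral:
  assumes "x \<in> L" and a: "a \<in> \<Phi>"
  shows "cartan_number ip x a = of_int (cartan_int x a)"
proof -
  have "x \<in> zspan \<Phi>" using assms roots_generate by simp
  then obtain n where x: "x = zcomb \<Phi> n"
    using zspan_zcomb[OF finite_roots] by auto
  have "cartan_number ip (zcomb B n) a \<in> \<int> \<and> zcomb B n \<in> L" if "B \<subseteq> \<Phi>" for B
    using finite_subset[OF that finite_roots] that
  proof (induction B)
    case empty
    have "0 \<in> L" using zmod.span_zero roots_generate by blast
    then show ?case
      using cartan_number_add_scale[of 0 0 a 1] a by (simp add: zcomb_def)
  next
    case (insert b B)
    have eq: "zcomb (insert b B) n = zcomb B n + zscale (n b) b"
      using insert by (simp add: zcomb_def)
    have b: "b \<in> \<Phi>" using insert by simp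
    then have "zcomb B n + zscale (n b) b \<in> L"
      using insert roots_generate by (metis insert_subset zmod.span_add zmod.span_scale root_in_L)
    then show ?case
      using insert b cartan_number_add_scale[of "zcomb B n" b a "n b"] root_in_L[OF b]
        cartan_integral[OF a b] a by (simp add: eq)
  qed
  then have "cartan_number ip x a \<in> \<int>" using x by blast
  then show ?thesis by (auto simp: cartan_int_def elim!: Ints_cases)
qed

lemma zlinear_on_cartan_int:
  assumes a: "a \<in> \<Phi>"
  shows "zlinear_on L (\<lambda>x. cartan_int x a)"
  unfolding zlinear_on_def
proof (intro ballI allI)
  fix x y n assume xy: "x \<in> L" "y \<in> L"
  then have "x + zscale n y \<in> L"
    using roots_generate by (metis zmod.span_add zmod.span_scale)
  then have "real_of_int (cartan_int (x + zscale n y) a)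
      = real_of_int (cartan_int x a + n * cartan_int y a)"
    using cartan_number_add_scale[OF xy a, of n] xy cartan_number_integral[OF _ a] by simp
  then show "cartan_int (x + zscale n y) a = cartan_int x a + n * cartan_int y a"
    by (simp only: of_int_eq_iff)
qed

lemma cartan_int_self: "a \<in> \<Phi> \<Longrightarrow> cartan_int a a = 2"
  by (simp add: cartan_int_def cartan_number_self)

text \<open>On functionals on the \<open>\<int>\<close>-span \<open>M\<close> of some roots, this is a positive definite quadratic
  form, invariant under the reflections in the roots in \<open>M\<close> and with integer values. It takes the
  place of the norm dual to the scalar product.\<close>

definition root_energy :: "'v set \<Rightarrow> ('v \<Rightarrow> int) \<Rightarrow> int"
  where "root_energy M F = (\<Sum>\<beta>\<in>\<Phi> \<inter> M. (F \<beta>)\<^sup>2)"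

text \<open>The functional on the left is the image of \<open>F\<close> under the reflection in the affine hyperplane
  \<open>F a = -t\<close>. Composing with the linear reflection \<open>s\<close>, which permutes the roots in \<open>M\<close>, turns it
  into \<open>F + t * \<langle>_, a\<rangle>\<close>. In the expanded square, the mixed term is evaluated by the same
  substitution. The energy changes by a positive multiple of \<open>t * (F a + t)\<close>, so it drops exactly
  when the hyperplane separates \<open>F\<close> from the zero functional.\<close>

lemma root_energy_shifted_reflection:
  assumes M: "M = zspan C" "C \<subseteq> \<Phi>" and F: "zlinear_on M F" and a: "a \<in> C"
  shows "root_energy M (\<lambda>x. F x - (F a + t) * cartan_int x a)
    = root_energy M F + t * (F a + t) * root_energy M (\<lambda>x. cartan_int x a)"
proof -
  define k where "k x = cartan_int x a" for x
  define R where "R = \<Phi> \<inter> M"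
  define s where "s = root_reflection ip a"
  have M_sub: "M \<subseteq> L" using M roots_generate zmod.span_mono by blast
  have aP: "a \<in> \<Phi>" and aM: "a \<in> M" using M a by (auto intro: zmod.span_base)
  have klin: "zlinear_on M k"
    unfolding k_def by (rule zlinear_on_subset[OF zlinear_on_cartan_int[OF aP] M_sub])
  have s_eq: "s x = x + zscale (- k x) a" if "x \<in> M" for x
    using cartan_number_integral[of x a] that M_sub aP
    by (auto simp: s_def root_reflection_def zscale_def k_def)
  have sM: "s x \<in> M" if "x \<in> M" for x
    unfolding s_eq[OF that] using that aM unfolding M(1) by (intro zmod.span_add zmod.span_scale)
  have ks: "k (s x) = - k x" if "x \<in> M" for x
    using zlinear_onD[OF klin that aM, of "- k x"] s_eq[OF that] cartan_int_self[OF aP]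
    by (simp add: k_def)
  have ss: "s (s x) = x" if "x \<in> M" for x
    using s_eq[OF that] s_eq[OF sM[OF that]] ks[OF that] by (simp add: zscale_def)
  have Fs: "F (s x) = F x - k x * F a" if "x \<in> M" for x
    using zlinear_onD[OF F that aM, of "- k x"] s_eq[OF that] by simp
  have "s ` \<Phi> = \<Phi>" unfolding s_def by (rule reflection_roots[OF aP])
  then have sR: "s x \<in> R" if "x \<in> R" for x using that sM by (auto simp: R_def)
  have reindex: "(\<Sum>x\<in>R. h (s x)) = (\<Sum>x\<in>R. h x)" for h :: "'v \<Rightarrow> int"
    by (rule sum.reindex_bij_witness[of _ s s]) (use sR ss in \<open>auto simp: R_def\<close>)
  define K where "K = (\<Sum>x\<in>R. (k x)\<^sup>2)"
  have "(\<Sum>x\<in>R. F x * k x) = (\<Sum>x\<in>R. F (s x) * k (s x))"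
    using reindex[of "\<lambda>x. F x * k x"] by simp
  also have "\<dots> = (\<Sum>x\<in>R. F a * (k x)\<^sup>2 - F x * k x)"
    by (rule sum.cong) (auto simp: R_def Fs ks power2_eq_square algebra_simps)
  finally have mixed: "2 * (\<Sum>x\<in>R. F x * k x) = F a * K"
    by (simp add: sum_subtractf K_def sum_distrib_left)
  have "(\<Sum>x\<in>R. (F x - (F a + t) * k x)\<^sup>2) = (\<Sum>x\<in>R. (F (s x) - (F a + t) * k (s x))\<^sup>2)"
    using reindex[of "\<lambda>x. (F x - (F a + t) * k x)\<^sup>2"] by simp
  also have "\<dots> = (\<Sum>x\<in>R. (F x + t * k x)\<^sup>2)"
    by (rule sum.cong) (auto simp: R_def Fs ks algebra_simps)
  also have "\<dots> = (\<Sum>x\<in>R. (F x)\<^sup>2 + t * (2 * (F x * k x)) + t\<^sup>2 * (k x)\<^sup>2)"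
    by (simp add: power2_eq_square algebra_simps)
  also have "\<dots> = (\<Sum>x\<in>R. (F x)\<^sup>2) + t * (2 * (\<Sum>x\<in>R. F x * k x)) + t\<^sup>2 * K"
    by (simp add: sum.distrib K_def flip: sum_distrib_left)
  also have "\<dots> = (\<Sum>x\<in>R. (F x)\<^sup>2) + t * (F a + t) * K"
    by (simp add: mixed power2_eq_square algebra_simps)
  finally show ?thesis by (simp add: root_energy_def R_def k_def K_def)
qed

lemma root_energy_nonneg: "root_energy M F \<ge> 0"
  by (simp add: root_energy_def sum_nonneg)

lemma root_energy_cartan_int_pos:
  assumes "a \<in> \<Phi>" "a \<in> M"
  shows "root_energy M (\<lambda>x. cartan_int x a) > 0"
  unfolding root_energy_def
  using assms cartan_int_self finite_roots by (intro sum_pos2[of _ a]) auto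

section \<open>Circuits of roots\<close>

text \<open>The descent into the alcove. Signs of the coefficients are kept: the reference point is
  \<open>sgn (c a) / T\<close>, and the alcove is given by \<open>sgn (c a) * g a \<ge> 0\<close>.\<close>

lemma circuit_has_unit_coefficient:
  assumes circ: "primitive_circuit C c" and CP: "C \<subseteq> \<Phi>"
  shows "\<exists>a\<in>C. \<bar>c a\<bar> = 1"
proof -
  define M where "M = zspan C"
  define T where "T = (\<Sum>a\<in>C. \<bar>c a\<bar>)"
  have fin: "finite C" and c0: "\<And>a. a \<in> C \<Longrightarrow> c a \<noteq> 0" and rel: "zcomb C c = 0"
    and gcd1: "Gcd (c ` C) = 1" and ne: "C \<noteq> {}"
    using circ by (auto simp: primitive_circuit_def)
  have T0: "T > 0" unfolding T_def using fin ne c0 by (intro sum_pos) auto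
  have csgn: "(\<Sum>a\<in>C. c a * sgn (c a)) = T"
    unfolding T_def by (rule sum.cong) (simp_all add: abs_sgn)
  \<comment> \<open>\<open>F\<close> is \<open>T\<close> times the difference between the integral point \<open>g\<close> and the reference point.\<close>
  define admissible where "admissible F g \<longleftrightarrow> zlinear_on M F \<and> (\<forall>a\<in>C. F a = T * g a - sgn (c a))"
    for F g
  have sum1: "(\<Sum>a\<in>C. c a * g a) = 1" if "admissible F g" for F g
  proof -
    have F: "zlinear_on (zspan C) F" using that by (simp add: admissible_def M_def)
    have "0 = F (zcomb C c)"
      using zlinear_on_zero[OF F zmod.span_zero] rel by simp
    also have "\<dots> = (\<Sum>a\<in>C. c a * F a)"
      using F fin by (rule zlinear_on_zcomb)
    also have "\<dots> = (\<Sum>a\<in>C. c a * (T * g a - sgn (c a)))"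
      using that by (intro sum.cong) (auto simp: admissible_def)
    also have "\<dots> = T * (\<Sum>a\<in>C. c a * g a) - T"
      by (simp add: algebra_simps sum_subtractf csgn sum_distrib_left)
    finally show ?thesis using T0 by simp
  qed
  obtain g0 where g0: "(\<Sum>a\<in>C. c a * g0 a) = 1"
    using bezout_finite[OF fin, of c] gcd1 by auto
  have "(\<Sum>a\<in>C. c a * (T * g0 a - sgn (c a))) = T * (\<Sum>a\<in>C. c a * g0 a) - T"
    by (simp add: algebra_simps sum_subtractf csgn sum_distrib_left)
  then have "(\<Sum>a\<in>C. c a * (T * g0 a - sgn (c a))) = 0" using g0 by simp
  from circuit_extend_zlinear[OF circ this] have "\<exists>F. admissible F g0"
    unfolding admissible_def M_def by metis
  then obtain F0 where F0: "\<exists>g. admissible F0 g" by blast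
  have "\<exists>F. (\<exists>g. admissible F g) \<and>
      (\<forall>F'. (\<exists>g. admissible F' g) \<longrightarrow> nat (root_energy M F) \<le> nat (root_energy M F'))"
    by (rule ex_has_least_nat[where P = "\<lambda>F. \<exists>g. admissible F g", OF F0])
  then obtain F where "(\<exists>g. admissible F g) \<and>
      (\<forall>F'. (\<exists>g. admissible F' g) \<longrightarrow> nat (root_energy M F) \<le> nat (root_energy M F'))"
    by (rule exE)
  then have "\<exists>g. admissible F g"
    and min: "\<And>F'. \<exists>g. admissible F' g \<Longrightarrow> nat (root_energy M F) \<le> nat (root_energy M F')"
    by (rule conjunct1, simp)
  from this(1) obtain g where Fg: "admissible F g" by (rule exE)
  have least: "nat (root_energy M F) \<le> nat (root_energy M F')" if "admissible F' g'" for F' g'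
    by (rule min, rule exI, rule that)
  have nonneg: "sgn (c a) * g a \<ge> 0" if a: "a \<in> C" for a
  proof (rule ccontr)
    assume neg: "\<not> sgn (c a) * g a \<ge> 0"
    have aP: "a \<in> \<Phi>" and aM: "a \<in> M" using a CP by (auto simp: M_def intro: zmod.span_base)
    have M_sub: "M \<subseteq> L" unfolding M_def using CP roots_generate zmod.span_mono by blast
    \<comment> \<open>Reflect in the wall \<open>g a = 0\<close>, which is \<open>F a = - sgn (c a)\<close> in terms of \<open>F\<close>.\<close>
    define F' where "F' x = F x - (F a + sgn (c a)) * cartan_int x a" for x
    define g' where "g' b = g b - g a * cartan_int b a" for b
    have Fa: "F a + sgn (c a) = T * g a" using Fg a by (simp add: admissible_def)
    have "admissible F' g'"
      unfolding admissible_def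
    proof
      show "zlinear_on M F'"
        unfolding F'_def using Fg zlinear_on_subset[OF zlinear_on_cartan_int[OF aP] M_sub]
        by (intro zlinear_on_diff_scale) (auto simp: admissible_def)
      show "\<forall>b\<in>C. F' b = T * g' b - sgn (c b)"
        using Fg unfolding F'_def Fa by (auto simp: g'_def admissible_def algebra_simps)
    qed
    then have le: "nat (root_energy M F) \<le> nat (root_energy M F')" by (rule least)
    have "root_energy M F' = root_energy M F
        + T * (sgn (c a) * g a) * root_energy M (\<lambda>x. cartan_int x a)"
      using root_energy_shifted_reflection[OF M_def CP _ a, of F "sgn (c a)"] Fg
      by (simp add: F'_def[abs_def] Fa admissible_def mult_ac)
    moreover have "T * (sgn (c a) * g a) * root_energy M (\<lambda>x. cartan_int x a) < 0"
      using neg unfolding not_le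
      by (rule mult_neg_pos[OF mult_pos_neg[OF T0] root_energy_cartan_int_pos[OF aP aM]])
    ultimately show False
      using le root_energy_nonneg[of M F] root_energy_nonneg[of M F'] by linarith
  qed
  have "\<exists>a\<in>C. g a \<noteq> 0"
  proof (rule ccontr)
    assume "\<not> (\<exists>a\<in>C. g a \<noteq> 0)"
    then have "(\<Sum>a\<in>C. c a * g a) = 0" by (intro sum.neutral) simp
    with sum1[OF Fg] show False by simp
  qed
  then obtain a where a: "a \<in> C" "g a \<noteq> 0" by blast
  \<comment> \<open>The nonnegative integers \<open>c b * g b\<close> add up to 1, so a nonzero one among them is 1.\<close>
  have summand_nonneg: "c b * g b \<ge> 0" if "b \<in> C" for b
  proof -
    have "c b * g b = \<bar>c b\<bar> * (sgn (c b) * g b)"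
      by (simp add: abs_mult_sgn flip: mult.assoc)
    also have "\<dots> \<ge> 0"
      using nonneg[OF that] by (rule mult_nonneg_nonneg[OF abs_ge_zero])
    finally show ?thesis .
  qed
  have "c a * g a \<le> 1"
    using sum1[OF Fg] member_le_sum[of a C "\<lambda>b. c b * g b"] summand_nonneg a fin by auto
  moreover have "c a * g a \<noteq> 0" using a c0 by simp
  ultimately have "c a * g a = 1" using summand_nonneg[OF a(1)] by linarith
  then have "c a dvd 1" by (metis dvd_triv_left)
  then show ?thesis using a by (auto simp: zdvd1_eq)
qed

lemma zdependent_roots_redundant:
  assumes "A \<subseteq> \<Phi>" "zdependent A"
  shows "\<exists>a\<in>A. a \<in> zspan (A - {a})"
proof -
  obtain C c where C: "C \<subseteq> A" and circ: "primitive_circuit C c"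
    using zdependent_contains_circuit assms finite_subset[OF _ finite_roots] by blast
  obtain a where a: "a \<in> C" "\<bar>c a\<bar> = 1"
    using circuit_has_unit_coefficient[OF circ] C assms by blast
  have fin: "finite C" and rel: "zcomb C c = 0" using circ by (auto simp: primitive_circuit_def)
  have "zscale (c a) a + zcomb (C - {a}) c = 0"
    using rel fin a unfolding zcomb_def by (subst (asm) sum.remove[of _ a]) auto
  then have "zscale (c a) (zscale (c a) a) = zscale (c a) (- zcomb (C - {a}) c)"
    by (metis add_eq_0_iff2)
  moreover have "c a * c a = 1" using a(2) by (metis abs_mult_self_eq mult_1)
  ultimately have "a = zscale (c a) (- zcomb (C - {a}) c)"
    by simp
  moreover have "zcomb (C - {a}) c \<in> zspan (C - {a})"
    using zspan_zcomb[of "C - {a}"] fin by blast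
  ultimately have "a \<in> zspan (C - {a})"
    by (metis zmod.span_neg zmod.span_scale)
  then show ?thesis using a C zmod.span_mono[of "C - {a}" "A - {a}"] by blast
qed

end

theorem theorem1p2:
  fixes L :: "'v::real_vector set"
    and ip :: "'v \<Rightarrow> 'v \<Rightarrow> real"
    and \<Phi> A :: "'v set"
  assumes "pn_root_lattice L ip \<Phi>"
    and "A \<subseteq> \<Phi>"
    and "zspan A = L"
  shows "\<exists>B \<subseteq> A. zbasis B L"
proof -
  interpret pn_root_lattice L ip \<Phi> by fact
  define G where "G = {B. B \<subseteq> A \<and> zspan B = L}"
  have "finite A" using assms finite_roots finite_subset by blast
  then have "finite G" "G \<noteq> {}" using assms by (auto simp: G_def)
  then obtain B where B: "B \<in> G" and min: "\<And>E. E \<in> G \<Longrightarrow> E \<subseteq> B \<Longrightarrow> B = E"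
    using finite_has_minimal[of G] by blast
  have "\<not> zdependent B"
  proof
    assume "zdependent B"
    then obtain a where a: "a \<in> B" "a \<in> zspan (B - {a})"
      using zdependent_roots_redundant[of B] B assms(2) by (auto simp: G_def)
    then have "B \<subseteq> zspan (B - {a})"
      using zmod.span_superset[of "B - {a}"] by blast
    then have "zspan (B - {a}) = zspan B"
      using zmod.span_superset[of B] unfolding zmod.span_eq by blast
    then have "B - {a} \<in> G" using B by (auto simp: G_def)
    with min[of "B - {a}"] a show False by blast
  qed
  then show ?thesis using B by (auto simp: G_def zbasis_def)
qed

end
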